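(* Let $q$ be an odd prime power and let $b,c,d\in\mathbb{F}_{q^2}$. The polynomial $g(x)=x^q+bx^2+cx+d\in\mathbb{F}_{q^2}[x]$ permutes $\mathbb{F}_{q^2}$ if and only if $b=0$ and $c\notin\mu_{q+1}$.
   Context: $\mathbb{F}_{q^2}$ is the finite field with $q^2$ elements. A polynomial permutes $\mathbb{F}_{q^2}$ if it induces a bijection of $\mathbb{F}_{q^2}$ onto itself. $\mu_{q+1}=\{x\in\mathbb{F}_{q^2}^*: x^{q+1}=1\}$. *)

theory Defs
  imports "HOL-Computational_Algebra.Polynomial" "HOL-Number_Theory.Prime_Powers" "HOL-Library.Cardinality"
begin

definition permutes_field :: "'a::{field,finite} poly \<Rightarrow> bool" where
  "permutes_field f \<longleftrightarrow> bij (poly f)"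

definition unity_roots :: "nat \<Rightarrow> 'a::{field,finite} set" ("\<mu>\<^bsub>_\<^esub>") where
  "\<mu>\<^bsub>n\<^esub> = {x. x \<noteq> 0 \<and> x ^ n = 1}"

end

theory Submission
  imports Defs
begin

text \<open>
  If \<open>b \<noteq> 0\<close>, the equation \<open>g (x + 1) = g x\<close> is linear in \<open>x\<close> with leading coefficient \<open>2 * b\<close>, which
  is nonzero in odd characteristic; it has a solution, so \<open>g\<close> is not injective.

  If \<open>b = 0\<close>, then \<open>g\<close> differs by the constant \<open>d\<close> from the additive map \<open>x \<mapsto> x ^ q + c * x\<close>, and on a
  finite field it permutes exactly when that map has trivial kernel.  A nonzero kernel element \<open>x\<close>
  satisfies \<open>x ^ q = - c * x\<close>; applying the Frobenius map \<open>x \<mapsto> x ^ q\<close> again and using \<open>x ^ (q ^ 2) = x\<close>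
  gives \<open>c ^ (q + 1) = 1\<close>.  The converse is Hilbert's Theorem 90 for the quadratic extension: if
  \<open>a = - c\<close> has norm \<open>a ^ (q + 1) = 1\<close>, then every value of \<open>u \<mapsto> u + a ^ q * u ^ q\<close> solves
  \<open>x ^ q = a * x\<close>, and not all of these values vanish, since a nonzero polynomial of degree \<open>q\<close> has
  at most \<open>q < q ^ 2\<close> roots.
\<close>

text \<open>
  Multiplication by a nonzero \<open>x\<close> permutes the nonzero elements, so it leaves their product
  unchanged.
\<close>

lemma power_CARD_eq_same:
  fixes x :: "'a::{field,finite}"
  shows "x ^ CARD('a) = x"
proof (cases "x = 0")
  case True
  then show ?thesis by (simp add: power_0_left)
next
  case False
  let ?P = "\<Prod>y\<in>UNIV-{0::'a}. y"
  have "bij_betw (\<lambda>y. x * y) (UNIV-{0}) (UNIV-{0})"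
    by (rule bij_betwI[of _ _ _ "\<lambda>y. y / x"]) (use False in auto)
  then have "(\<Prod>y\<in>UNIV-{0}. x * y) = ?P"
    by (rule prod.reindex_bij_betw)
  then have "x ^ (CARD('a) - 1) * ?P = ?P"
    by (simp add: prod.distrib card_Diff_subset)
  moreover have "?P \<noteq> 0"
    by simp
  ultimately have *: "x ^ (CARD('a) - 1) = 1"
    by simp
  have "x ^ CARD('a) = x ^ Suc (CARD('a) - 1)"
    by simp
  also have "\<dots> = x"
    unfolding power_Suc * by simp
  finally show ?thesis .
qed

text \<open>Translation by \<open>1\<close> permutes the elements, so it leaves their sum unchanged.\<close>

lemma of_nat_CARD_eq_0: "of_nat CARD('a::{field,finite}) = (0::'a)"
proof -
  have "bij_betw (\<lambda>y::'a. y + 1) UNIV UNIV"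
    by (rule bij_betwI[of _ _ _ "\<lambda>y. y - 1"]) auto
  then have "(\<Sum>y\<in>UNIV. y + 1) = (\<Sum>y\<in>UNIV. y::'a)"
    by (rule sum.reindex_bij_betw)
  then show ?thesis
    by (simp add: sum.distrib)
qed

text \<open>
  The characteristic divides the number \<open>q ^ n\<close> of elements, so it is the prime of which \<open>q\<close> is a
  power.
\<close>

lemma primepow_eq_CHAR_power:
  assumes "primepow q" and "CARD('a::{field,finite}) = q ^ n"
  obtains k where "prime CHAR('a)" and "q = CHAR('a) ^ k" and "k > 0"
proof -
  from \<open>primepow q\<close> obtain p k where p: "prime p" "k > 0" "q = p ^ k"
    by (auto simp: primepow_def)
  have pos: "CHAR('a) > 0"
    by (rule finite_imp_CHAR_pos) simp
  then have prime: "prime CHAR('a)"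
    by (rule prime_CHAR_semidom)
  have "CHAR('a) dvd (p ^ k) ^ n"
    using of_nat_CARD_eq_0[where ?'a = 'a] assms(2) p(3)
    by (simp only: of_nat_eq_0_iff_char_dvd)
  with prime have "CHAR('a) dvd p"
    by (meson prime_dvd_power)
  with prime p(1) have "CHAR('a) = p"
    by (simp add: primes_dvd_imp_eq)
  with that prime p show thesis
    by blast
qed

lemma frobenius_add:
  fixes x y :: "'a::{field,finite}"
  assumes "primepow q" and "CARD('a) = q ^ n"
  shows "(x + y) ^ q = x ^ q + y ^ q"
  using primepow_eq_CHAR_power[OF assms] freshmans_dream' by metis

lemma two_nonzero_of_odd:
  assumes "primepow q" and "odd q" and "CARD('a::{field,finite}) = q ^ n"
  shows "(2::'a) \<noteq> 0"
proof
  assume "(2::'a) = 0"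
  then have "CHAR('a) dvd 2"
    using of_nat_eq_0_iff_char_dvd[where ?'a = 'a, of 2] by simp
  moreover obtain k where "prime CHAR('a)" "q = CHAR('a) ^ k" "k > 0"
    using primepow_eq_CHAR_power[OF assms(1,3)] .
  ultimately show False
    using \<open>odd q\<close> by (metis dvd_power primes_dvd_imp_eq two_is_prime_nat)
qed

text \<open>
  This is Hilbert's Theorem 90 for a quadratic extension: \<open>u + a ^ q * u ^ q\<close> is Lagrange's resolvent,
  which the Frobenius map multiplies by \<open>a\<close> because \<open>a ^ q\<close> is the inverse of \<open>a\<close>.
\<close>

lemma hilbert90_quadratic:
  fixes a :: "'a::{field,finite}"
  assumes "primepow q" and card: "CARD('a) = q ^ 2" and norm: "a ^ (q + 1) = 1"
  obtains x where "x \<noteq> 0" and "x ^ q = a * x"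
proof -
  have q: "q > 1"
    using primepow_gt_Suc_0[OF assms(1)] by simp
  have invol: "(y ^ q) ^ q = y" for y :: 'a
    using power_CARD_eq_same[of y] card by (simp add: power2_eq_square flip: power_mult)
  define r where "r = monom 1 1 + monom (a ^ q) q"
  have r: "poly r u = u + a ^ q * u ^ q" for u
    by (simp add: r_def poly_monom)
  have "coeff r 1 = 1"
    using q by (simp add: r_def)
  then have "r \<noteq> 0"
    by auto
  have "degree r \<le> q"
    unfolding r_def using q
    by (intro degree_add_le) (auto intro: order.trans[OF degree_monom_le])
  with card_poly_roots_bound[OF \<open>r \<noteq> 0\<close>] have "card {u. poly r u = 0} \<le> q"
    by linarith
  also have "q < CARD('a)"
    using q card by (simp add: power2_eq_square)
  finally have "{u. poly r u = 0} \<noteq> UNIV"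
    by auto
  then obtain u where u: "poly r u \<noteq> 0"
    by auto
  have "poly r u ^ q = u ^ q + a * u"
    by (simp add: r frobenius_add[OF assms(1,2)] power_mult_distrib invol)
  also have "\<dots> = a * poly r u"
    using norm by (simp add: r algebra_simps flip: mult.assoc)
  finally show thesis
    using u that by blast
qed

theorem mainTheorem5:
  fixes q :: nat and b c d :: "'a::{field,finite}"
  assumes "primepow q" and "odd q"
    and "CARD('a) = q ^ 2"
  shows "permutes_field (monom 1 q + monom b 2 + monom c 1 + monom d 0)
    \<longleftrightarrow> b = 0 \<and> c \<notin> \<mu>\<^bsub>q + 1\<^esub>"
proof -
  let ?g = "monom 1 q + monom b 2 + monom c 1 + monom d 0"
  have q: "q > 0"
    using primepow_gt_0_nat[OF assms(1)] .
  have g: "poly ?g x = x ^ q + b * x ^ 2 + c * x + d" for x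
    by (simp add: poly_monom)
  note add = frobenius_add[OF assms(1,3)]
  have invol: "(y ^ q) ^ q = y" for y :: 'a
    using power_CARD_eq_same[of y] assms(3) by (simp add: power2_eq_square flip: power_mult)
  have perm: "permutes_field ?g \<longleftrightarrow> inj (poly ?g)"
    unfolding permutes_field_def bij_def using finite_UNIV_inj_surj[of "poly ?g"] by auto
  have even: "(- y) ^ (q + 1) = y ^ (q + 1)" for y :: 'a
    using \<open>odd q\<close> by simp
  show ?thesis
  proof (intro iffI conjI)
    assume "permutes_field ?g"
    then have inj: "inj (poly ?g)"
      using perm by simp
    show b: "b = 0"
    proof (rule ccontr)
      assume "b \<noteq> 0"
      (* the solution of the linear equation g (x + 1) = g x *)
      define x where "x = - (1 + b + c) / (2 * b)"
      have "2 * b * x = - (1 + b + c)"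
        using \<open>b \<noteq> 0\<close> two_nonzero_of_odd[OF assms] by (simp add: x_def)
      then have "poly ?g (x + 1) = poly ?g x"
        unfolding g add by (simp add: power2_eq_square) algebra
      with inj have "x + 1 = x"
        by (rule injD)
      then show False
        by simp
    qed
    show "c \<notin> \<mu>\<^bsub>q + 1\<^esub>"
    proof
      assume "c \<in> \<mu>\<^bsub>q + 1\<^esub>"
      then have "(- c) ^ (q + 1) = 1"
        unfolding even by (simp add: unity_roots_def)
      then obtain x where x: "x \<noteq> 0" "x ^ q = - c * x"
        using hilbert90_quadratic[OF assms(1,3)] by blast
      then have "poly ?g x = poly ?g 0"
        unfolding g using q b by simp
      with inj have "x = 0"
        by (rule injD)
      with x show False
        by simp
    qed
  next
    assume asm: "b = 0 \<and> c \<notin> \<mu>\<^bsub>q + 1\<^esub>"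
    have "inj (poly ?g)"
    proof (rule injI, rule ccontr)
      fix x y
      assume eq: "poly ?g x = poly ?g y" and "x \<noteq> y"
      define z where "z = x - y"
      have "z \<noteq> 0"
        using \<open>x \<noteq> y\<close> by (simp add: z_def)
      have "x ^ q = z ^ q + y ^ q"
        using add[of z y] by (simp add: z_def)
      with eq asm have "z ^ q + c * x = c * y"
        unfolding g by simp
      then have z: "z ^ q = (- c) * z"
        by (simp add: z_def algebra_simps)
      have "z = (- c) ^ q * (z ^ q)"
        using invol[of z] unfolding z power_mult_distrib by simp
      also have "\<dots> = (- c) ^ (q + 1) * z"
        unfolding z by simp
      finally have "c ^ (q + 1) = 1"
        using \<open>z \<noteq> 0\<close> unfolding even by simp
      then have "c \<in> \<mu>\<^bsub>q + 1\<^esub>"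
        by (auto simp: unity_roots_def)
      with asm show False
        by simp
    qed
    then show "permutes_field ?g"
      using perm by simp
  qed
qed

end
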